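(* Let $(X,\mathcal{T})$ be a topological space and let $\mathcal{T}^{\alpha}$ be the topology on $X$ consisting of all $\alpha$-sets of $(X,\mathcal{T})$. Then the following conditions are equivalent: (a) $(X,\mathcal{T})$ is para-$S$-closed. (b) Every cover of $X$ by regular closed sets of $(X,\mathcal{T})$ has a locally finite (in $(X,\mathcal{T})$) refinement consisting of regular closed sets of $(X,\mathcal{T})$. (c) Every cover of $X$ by regular closed sets of $(X,\mathcal{T}^{\alpha})$ has a locally finite (in $(X,\mathcal{T}^{\alpha})$) refinement consisting of regular closed sets of $(X,\mathcal{T}^{\alpha})$. (d) $(X,\mathcal{T}^{\alpha})$ is para-$S$-closed.
   Context: No separation axioms are assumed. Let $A\subseteq X$, with interior $\mathrm{Int}\,A$ and closure $\mathrm{Cl}\,A$ in $(X,\mathcal{T})$. The set $A$ is semi-open if $A\subseteq \mathrm{Cl}(\mathrm{Int}\,A)$; regular open if $A=\mathrm{Int}(\mathrm{Cl}\,A)$; regular closed if its complement is regular open (equivalently $A=\mathrm{Cl}(\mathrm{Int}\,A)$); an $\alpha$-set if $A\subseteq \mathrm{Int}(\mathrm{Cl}(\mathrm{Int}\,A))$. The collection $\mathcal{T}^{\alpha}$ of all $\alpha$-sets is a topology on $X$ finer than $\mathcal{T}$ (Njåstad). All notions for $(X,\mathcal{T}^{\alpha})$ are taken with respect to $\mathcal{T}^{\alpha}$. A family $\mathcal{V}$ of subsets refines a cover $\mathcal{U}$ if each member of $\mathcal{V}$ is contained in some member of $\mathcal{U}$. A refinement in (b) and (c) is, as usual, also a cover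 of $X$. A space is para-$S$-closed if for every cover $\mathcal{U}$ of it by semi-open sets there is a locally finite family of semi-open sets that refines $\mathcal{U}$ and whose union is dense in the space (the family itself need not cover the space). *)

theory Defs
  imports "HOL-Analysis.Analysis"
begin

definition semi_open_in :: "'a topology \<Rightarrow> 'a set \<Rightarrow> bool" where
  "semi_open_in X A \<longleftrightarrow> A \<subseteq> X closure_of (X interior_of A)"

definition regular_open_in :: "'a topology \<Rightarrow> 'a set \<Rightarrow> bool" where
  "regular_open_in X A \<longleftrightarrow> A = X interior_of (X closure_of A)"

definition regular_closed_in :: "'a topology \<Rightarrow> 'a set \<Rightarrow> bool" where
  "regular_closed_in X A \<longleftrightarrow> A \<subseteq> topspace X \<and> regular_open_in X (topspace X - A)"

definition alpha_set_in :: "'a topology \<Rightarrow> 'a set \<Rightarrow> bool" where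
  "alpha_set_in X A \<longleftrightarrow> A \<subseteq> X interior_of (X closure_of (X interior_of A))"

definition alpha_topology :: "'a topology \<Rightarrow> 'a topology" where
  "alpha_topology X = topology (alpha_set_in X)"

definition refines_cover :: "'a set set \<Rightarrow> 'a set set \<Rightarrow> bool" where
  "refines_cover \<V> \<U> \<longleftrightarrow> (\<forall>V\<in>\<V>. \<exists>U\<in>\<U>. V \<subseteq> U)"

(* The refining family need not cover the space; only its union has to be dense. *)
definition para_S_closed :: "'a topology \<Rightarrow> bool" where
  "para_S_closed X \<longleftrightarrow>
    (\<forall>\<U>. (\<forall>U\<in>\<U>. semi_open_in X U) \<and> \<Union>\<U> = topspace X \<longrightarrow>
      (\<exists>\<V>. locally_finite_in X \<V> \<and> (\<forall>V\<in>\<V>. semi_open_in X V) \<and>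
           refines_cover \<V> \<U> \<and> X closure_of \<Union>\<V> = topspace X))"

definition regular_closed_refinable :: "'a topology \<Rightarrow> bool" where
  "regular_closed_refinable X \<longleftrightarrow>
    (\<forall>\<U>. (\<forall>U\<in>\<U>. regular_closed_in X U) \<and> \<Union>\<U> = topspace X \<longrightarrow>
      (\<exists>\<V>. locally_finite_in X \<V> \<and> (\<forall>V\<in>\<V>. regular_closed_in X V) \<and>
           refines_cover \<V> \<U> \<and> \<Union>\<V> = topspace X))"

(* Njastad's theorem, which ensures that alpha_topology is not a junk value. *)
lemma istopology_alpha_set_in: "istopology (alpha_set_in X)"
  unfolding istopology_def
proof (intro conjI allI impI)
  fix S T assume S: "alpha_set_in X S" and T: "alpha_set_in X T"
  let ?IS = "X interior_of S" and ?IT = "X interior_of T"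
  let ?US = "X interior_of (X closure_of ?IS)" and ?UT = "X interior_of (X closure_of ?IT)"
  have "?US \<inter> ?UT \<subseteq> ?US \<inter> X closure_of ?IT"
    by (rule Int_mono[OF order_refl interior_of_subset])
  also have "\<dots> \<subseteq> X closure_of (?US \<inter> ?IT)"
    by (rule openin_Int_closure_of_subset[OF openin_interior_of])
  also have "\<dots> \<subseteq> X closure_of (?IT \<inter> X closure_of ?IS)"
    unfolding Int_commute[of ?US]
    by (rule closure_of_mono[OF Int_mono[OF order_refl interior_of_subset]])
  also have "\<dots> \<subseteq> X closure_of (X closure_of (?IT \<inter> ?IS))"
    by (rule closure_of_mono[OF openin_Int_closure_of_subset[OF openin_interior_of]])
  also have "\<dots> = X closure_of (X interior_of (S \<inter> T))"
    by (simp only: closure_of_closure_of interior_of_Int Int_commute)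
  finally have "?US \<inter> ?UT \<subseteq> X interior_of (X closure_of (X interior_of (S \<inter> T)))"
    by (rule interior_of_maximal) (rule openin_Int[OF openin_interior_of openin_interior_of])
  moreover have "S \<inter> T \<subseteq> ?US \<inter> ?UT"
    using S T unfolding alpha_set_in_def by (rule Int_mono)
  ultimately show "alpha_set_in X (S \<inter> T)"
    unfolding alpha_set_in_def by (rule order_trans[rotated])
next
  fix \<K> assume \<K>: "\<forall>K\<in>\<K>. alpha_set_in X K"
  show "alpha_set_in X (\<Union>\<K>)"
    unfolding alpha_set_in_def
  proof (rule Union_least)
    fix K assume "K \<in> \<K>"
    then have "K \<subseteq> X interior_of (X closure_of (X interior_of K))"
      using \<K> by (simp add: alpha_set_in_def)
    also have "\<dots> \<subseteq> X interior_of (X closure_of (X interior_of \<Union>\<K>))"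
      using \<open>K \<in> \<K>\<close> by (intro interior_of_mono closure_of_mono Union_upper)
    finally show "K \<subseteq> X interior_of (X closure_of (X interior_of \<Union>\<K>))" .
  qed
qed

lemma openin_alpha_topology [simp]: "openin (alpha_topology X) = alpha_set_in X"
  by (simp add: alpha_topology_def istopology_alpha_set_in)

lemma openin_imp_alpha_set_in: "openin X S \<Longrightarrow> alpha_set_in X S"
  by (simp add: alpha_set_in_def interior_of_openin interior_of_maximal
      closure_of_subset openin_subset)

lemma topspace_alpha_topology [simp]: "topspace (alpha_topology X) = topspace X"
proof (rule subset_antisym)
  have "alpha_set_in X (topspace (alpha_topology X))"
    using openin_topspace[of "alpha_topology X"] by simp
  then show "topspace (alpha_topology X) \<subseteq> topspace X"
    using interior_of_subset_topspace unfolding alpha_set_in_def by (rule order_trans)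
  have "openin (alpha_topology X) (topspace X)"
    by (simp add: openin_imp_alpha_set_in)
  then show "topspace X \<subseteq> topspace (alpha_topology X)"
    by (rule openin_subset)
qed

end

theory Submission
  imports Defs
begin

text \<open>
  Two observations carry the proof.

  In an arbitrary space, para-\<open>S\<close>-closedness is a statement about regular closed covers only
  (\<open>para_S_closed_iff_regular_closed_refinable\<close>).  The closure of a semi-open set is regular
  closed, so passing to closures turns semi-open covers into regular closed ones, and it turns a
  locally finite semi-open family with dense union into a locally finite regular closed cover.
  In the other direction, a regular closed set \<open>V\<close> contained in the closure of a semi-open set
  \<open>U\<close> is the closure of the open set \<open>Int V \<inter> Int U\<close>, which lies inside \<open>U\<close>.

  Regular closed covers and their local finiteness are the same for \<open>X\<close> and for its
  \<open>\<alpha>\<close>-topology.  Both facts rest on \<open>semi_open_in_meets_alpha_set_in\<close>: an \<open>\<alpha>\<close>-set \<open>W\<close> can be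
  enlarged to the open set \<open>Int (Cl (Int W))\<close> without meeting any further semi-open set.  So,
  as long as only semi-open sets are tested, \<open>\<alpha>\<close>-neighbourhoods and ordinary neighbourhoods of a
  point detect the same closures and the same local finiteness.

  Applying the first observation to \<open>X\<close> and to its \<open>\<alpha>\<close>-topology, and connecting the two
  instances by the second, gives the theorem.
\<close>

section \<open>Semi-open and regular closed sets\<close>

lemma semi_open_in_openin: "openin X U \<Longrightarrow> semi_open_in X U"
  by (simp add: semi_open_in_def interior_of_openin closure_of_subset openin_subset)

lemma semi_open_in_subset_topspace: "semi_open_in X A \<Longrightarrow> A \<subseteq> topspace X"
  unfolding semi_open_in_def by (erule order_trans[OF _ closure_of_subset_topspace])

lemma semi_open_in_alpha_set_in: "alpha_set_in X W \<Longrightarrow> semi_open_in X W"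
  unfolding alpha_set_in_def semi_open_in_def by (erule order_trans[OF _ interior_of_subset])

lemma closure_of_interior_of_semi_open_in:
  assumes "semi_open_in X A"
  shows "X closure_of (X interior_of A) = X closure_of A"
proof (rule subset_antisym)
  show "X closure_of (X interior_of A) \<subseteq> X closure_of A"
    by (rule closure_of_mono[OF interior_of_subset])
  show "X closure_of A \<subseteq> X closure_of (X interior_of A)"
    using assms by (simp add: semi_open_in_def closure_of_minimal)
qed

lemma regular_closed_in_iff: "regular_closed_in X A \<longleftrightarrow> X closure_of (X interior_of A) = A"
proof (cases "A \<subseteq> topspace X")
  case True
  have "X interior_of (X closure_of (topspace X - A)) =
      topspace X - X closure_of (X interior_of A)"
    by (simp add: closure_of_complement interior_of_complement)
  then show ?thesis
    using True closure_of_subset_topspace[of X "X interior_of A"]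
    unfolding regular_closed_in_def regular_open_in_def by auto
next
  case False
  then show ?thesis
    using closure_of_subset_topspace[of X "X interior_of A"]
    by (auto simp: regular_closed_in_def)
qed

lemma regular_closed_in_imp_closedin: "regular_closed_in X A \<Longrightarrow> closedin X A"
  unfolding regular_closed_in_iff using closedin_closure_of[of X "X interior_of A"] by simp

lemma regular_closed_in_imp_semi_open_in: "regular_closed_in X A \<Longrightarrow> semi_open_in X A"
  by (simp add: regular_closed_in_iff semi_open_in_def)

lemma regular_closed_in_closure_of:
  assumes "semi_open_in X A"
  shows "regular_closed_in X (X closure_of A)"
  unfolding regular_closed_in_iff
proof (rule subset_antisym)
  show "X closure_of (X interior_of (X closure_of A)) \<subseteq> X closure_of A"
    by (simp add: closure_of_minimal interior_of_subset)
  have "X interior_of A \<subseteq> X interior_of (X closure_of A)"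
    by (intro interior_of_mono closure_of_subset semi_open_in_subset_topspace assms)
  then show "X closure_of A \<subseteq> X closure_of (X interior_of (X closure_of A))"
    unfolding closure_of_interior_of_semi_open_in[OF assms, symmetric]
    by (rule closure_of_mono)
qed

section \<open>Para-\<open>S\<close>-closedness through regular closed covers\<close>

text \<open>
  A closed set containing \<open>V\<close> contains its closure, so closures of a refinement still refine a
  regular closed cover; local finiteness makes the union of these closures closed, hence all of
  the space.
\<close>

lemma para_S_closed_imp_regular_closed_refinable:
  assumes "para_S_closed X"
  shows "regular_closed_refinable X"
  unfolding regular_closed_refinable_def
proof (intro allI impI, elim conjE)
  fix \<U>
  assume \<U>: "\<forall>U\<in>\<U>. regular_closed_in X U" and cov: "\<Union>\<U> = topspace X"
  then have "(\<forall>U\<in>\<U>. semi_open_in X U) \<and> \<Union>\<U> = topspace X"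
    by (simp add: regular_closed_in_imp_semi_open_in)
  from assms[unfolded para_S_closed_def, rule_format, OF this]
  obtain \<V> where fin: "locally_finite_in X \<V>" and semi: "\<forall>V\<in>\<V>. semi_open_in X V"
    and ref: "refines_cover \<V> \<U>" and dense: "X closure_of \<Union>\<V> = topspace X"
    by (elim exE conjE) (rule that; assumption)
  let ?\<C> = "(\<lambda>V. X closure_of V) ` \<V>"
  have "locally_finite_in X ?\<C>"
    by (rule locally_finite_in_closure[OF fin])
  moreover have "\<forall>C\<in>?\<C>. regular_closed_in X C"
    using semi by (simp add: regular_closed_in_closure_of)
  moreover have "refines_cover ?\<C> \<U>"
    unfolding refines_cover_def
  proof (intro ballI, elim imageE)
    fix C V assume C: "C = X closure_of V" and "V \<in> \<V>"
    then obtain U where "U \<in> \<U>" "V \<subseteq> U"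
      using ref unfolding refines_cover_def by blast
    then have "C \<subseteq> U"
      unfolding C using \<U> by (intro closure_of_minimal regular_closed_in_imp_closedin) auto
    with \<open>U \<in> \<U>\<close> show "\<exists>U\<in>\<U>. C \<subseteq> U" ..
  qed
  moreover have "\<Union>?\<C> = topspace X"
    using closure_of_locally_finite_Union[OF fin] dense by simp
  ultimately show "\<exists>\<V>. locally_finite_in X \<V> \<and> (\<forall>V\<in>\<V>. regular_closed_in X V) \<and>
      refines_cover \<V> \<U> \<and> \<Union>\<V> = topspace X"
    by blast
qed

text \<open>
  An intersection of two semi-open sets may fail to be semi-open, so a member \<open>V\<close> of the
  refinement is cut down by interiors: \<open>Int U\<close> is dense in \<open>U\<close>, so \<open>Int V \<inter> Int U\<close> remains dense
  in \<open>Int V\<close>, and therefore in \<open>V\<close>.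
\<close>

lemma regular_closed_in_subset_closure_of_Int_interiors:
  assumes V: "regular_closed_in X V" and U: "semi_open_in X U" and sub: "V \<subseteq> X closure_of U"
  shows "V \<subseteq> X closure_of (X interior_of V \<inter> X interior_of U)"
proof -
  have "X interior_of V \<subseteq> X interior_of V \<inter> X closure_of (X interior_of U)"
    using sub interior_of_subset[of X V]
    by (auto simp: closure_of_interior_of_semi_open_in[OF U])
  also have "\<dots> \<subseteq> X closure_of (X interior_of V \<inter> X interior_of U)"
    by (rule openin_Int_closure_of_subset[OF openin_interior_of])
  finally have "X closure_of (X interior_of V) \<subseteq>
      X closure_of (X interior_of V \<inter> X interior_of U)"
    by (rule closure_of_minimal) simp
  then show ?thesis
    using V by (simp add: regular_closed_in_iff)
qed

lemma regular_closed_refinable_imp_para_S_closed: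
  assumes "regular_closed_refinable X"
  shows "para_S_closed X"
  unfolding para_S_closed_def
proof (intro allI impI, elim conjE)
  fix \<U>
  assume \<U>: "\<forall>U\<in>\<U>. semi_open_in X U" and cov: "\<Union>\<U> = topspace X"
  let ?\<C> = "(\<lambda>U. X closure_of U) ` \<U>"
  have "\<forall>C\<in>?\<C>. regular_closed_in X C"
    using \<U> by (simp add: regular_closed_in_closure_of)
  moreover have "\<Union>?\<C> = topspace X"
  proof (rule subset_antisym)
    show "\<Union>?\<C> \<subseteq> topspace X"
      by (simp add: UN_least closure_of_subset_topspace)
    have "U \<subseteq> X closure_of U" if "U \<in> \<U>" for U
      using \<U> that by (simp add: closure_of_subset semi_open_in_subset_topspace)
    then show "topspace X \<subseteq> \<Union>?\<C>"
      unfolding cov[symmetric] by blast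
  qed
  ultimately have "(\<forall>C\<in>?\<C>. regular_closed_in X C) \<and> \<Union>?\<C> = topspace X" ..
  from assms[unfolded regular_closed_refinable_def, rule_format, OF this]
  obtain \<V> where fin: "locally_finite_in X \<V>" and reg: "\<forall>V\<in>\<V>. regular_closed_in X V"
    and ref: "refines_cover \<V> ?\<C>" and covV: "\<Union>\<V> = topspace X"
    by (elim exE conjE) (rule that; assumption)
  from ref have "\<forall>V\<in>\<V>. \<exists>U\<in>\<U>. V \<subseteq> X closure_of U"
    by (simp add: refines_cover_def)
  then obtain u where u: "\<And>V. V \<in> \<V> \<Longrightarrow> u V \<in> \<U> \<and> V \<subseteq> X closure_of (u V)"
    by metis
  define f where "f V = X interior_of V \<inter> X interior_of (u V)" for V
  have "locally_finite_in X (f ` \<V>)"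
    by (rule locally_finite_in_refinement[OF fin])
      (auto simp: f_def dest: subsetD[OF interior_of_subset])
  moreover have "\<forall>W\<in>f ` \<V>. semi_open_in X W"
    unfolding f_def by (blast intro: semi_open_in_openin openin_Int openin_interior_of)
  moreover have "refines_cover (f ` \<V>) \<U>"
    unfolding refines_cover_def
  proof (intro ballI, elim imageE)
    fix W V assume "W = f V" and "V \<in> \<V>"
    then have "u V \<in> \<U>" "W \<subseteq> u V"
      using u interior_of_subset[of X "u V"] unfolding f_def by blast+
    then show "\<exists>U\<in>\<U>. W \<subseteq> U" ..
  qed
  moreover have "X closure_of \<Union>(f ` \<V>) = topspace X"
  proof (rule subset_antisym[OF closure_of_subset_topspace])
    have "V \<subseteq> X closure_of \<Union>(f ` \<V>)" if "V \<in> \<V>" for V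
    proof -
      have "V \<subseteq> X closure_of (f V)"
        unfolding f_def using reg \<U> u that
        by (intro regular_closed_in_subset_closure_of_Int_interiors) auto
      also have "\<dots> \<subseteq> X closure_of \<Union>(f ` \<V>)"
        using that by (intro closure_of_mono) blast
      finally show ?thesis .
    qed
    then show "topspace X \<subseteq> X closure_of \<Union>(f ` \<V>)"
      unfolding covV[symmetric] by blast
  qed
  ultimately show "\<exists>\<V>. locally_finite_in X \<V> \<and> (\<forall>V\<in>\<V>. semi_open_in X V) \<and>
      refines_cover \<V> \<U> \<and> X closure_of \<Union>\<V> = topspace X"
    by blast
qed

theorem para_S_closed_iff_regular_closed_refinable:
  "para_S_closed X \<longleftrightarrow> regular_closed_refinable X"
  using para_S_closed_imp_regular_closed_refinable regular_closed_refinable_imp_para_S_closed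
  by blast

section \<open>Comparison with the \<open>\<alpha>\<close>-topology\<close>

text \<open>
  Density is used twice: \<open>Int A\<close> is dense in \<open>A\<close>, which moves the meeting point into \<open>Int A\<close>,
  and \<open>Int W\<close> is dense in \<open>Cl (Int W)\<close>, which then moves it into \<open>Int W\<close>.
\<close>

lemma semi_open_in_meets_alpha_set_in:
  assumes A: "semi_open_in X A"
    and meets: "A \<inter> X interior_of (X closure_of (X interior_of W)) \<noteq> {}"
  shows "A \<inter> W \<noteq> {}"
proof -
  let ?G = "X interior_of (X closure_of (X interior_of W))"
  have "?G \<inter> X closure_of (X interior_of A) \<noteq> {}"
    using A meets unfolding semi_open_in_def by blast
  then have "?G \<inter> X interior_of A \<noteq> {}"
    by (simp add: openin_Int_closure_of_eq_empty)
  then have "X interior_of A \<inter> X closure_of (X interior_of W) \<noteq> {}"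
    using interior_of_subset[of X "X closure_of (X interior_of W)"] by blast
  then have "X interior_of A \<inter> X interior_of W \<noteq> {}"
    by (simp add: openin_Int_closure_of_eq_empty)
  then show ?thesis
    using interior_of_subset[of X A] interior_of_subset[of X W] by blast
qed

lemma alpha_topology_closure_of_semi_open_in:
  assumes "semi_open_in X A"
  shows "alpha_topology X closure_of A = X closure_of A"
proof (rule subset_antisym)
  show "alpha_topology X closure_of A \<subseteq> X closure_of A"
  proof
    fix x assume x: "x \<in> alpha_topology X closure_of A"
    have "\<exists>y. y \<in> A \<and> y \<in> T" if "x \<in> T \<and> openin X T" for T
    proof -
      have "openin (alpha_topology X) T"
        using that openin_imp_alpha_set_in[of X T] by simp
      then show ?thesis
        using x that unfolding in_closure_of by blast
    qed
    then show "x \<in> X closure_of A"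
      using x unfolding in_closure_of topspace_alpha_topology by blast
  qed
  show "X closure_of A \<subseteq> alpha_topology X closure_of A"
  proof
    fix x assume x: "x \<in> X closure_of A"
    have "\<exists>y. y \<in> A \<and> y \<in> W" if W: "x \<in> W" "alpha_set_in X W" for W
    proof -
      have "x \<in> X interior_of (X closure_of (X interior_of W))"
        using W by (auto simp: alpha_set_in_def)
      then have "A \<inter> X interior_of (X closure_of (X interior_of W)) \<noteq> {}"
        using x openin_interior_of unfolding in_closure_of by blast
      then show ?thesis
        using semi_open_in_meets_alpha_set_in[OF assms] by blast
    qed
    then show "x \<in> alpha_topology X closure_of A"
      using x by (auto simp: in_closure_of)
  qed
qed

text \<open>
  Regular closed sets are the closures of open sets.  Open sets of either topology are semi-open
  in \<open>X\<close>, so their closures in the two topologies agree.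
\<close>

lemma regular_closed_in_alpha_topology:
  "regular_closed_in (alpha_topology X) A \<longleftrightarrow> regular_closed_in X A"
proof
  let ?W = "alpha_topology X interior_of A"
  assume "regular_closed_in (alpha_topology X) A"
  then have "A = alpha_topology X closure_of ?W"
    by (simp add: regular_closed_in_iff)
  moreover have W: "semi_open_in X ?W"
    using openin_interior_of[of "alpha_topology X" A] by (simp add: semi_open_in_alpha_set_in)
  ultimately have "A = X closure_of ?W"
    by (simp add: alpha_topology_closure_of_semi_open_in)
  then show "regular_closed_in X A"
    using regular_closed_in_closure_of[OF W] by simp
next
  let ?W = "X interior_of A"
  assume "regular_closed_in X A"
  then have A: "A = alpha_topology X closure_of ?W"
    by (simp add: alpha_topology_closure_of_semi_open_in semi_open_in_openin regular_closed_in_iff)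
  have "semi_open_in (alpha_topology X) ?W"
    by (simp add: semi_open_in_openin openin_imp_alpha_set_in)
  from regular_closed_in_closure_of[OF this] show "regular_closed_in (alpha_topology X) A"
    using A by simp
qed

lemma locally_finite_in_alpha_topology:
  assumes semi: "\<forall>V\<in>\<V>. semi_open_in X V"
  shows "locally_finite_in (alpha_topology X) \<V> \<longleftrightarrow> locally_finite_in X \<V>"
proof
  assume fin: "locally_finite_in (alpha_topology X) \<V>"
  have "\<exists>G. openin X G \<and> x \<in> G \<and> finite {V \<in> \<V>. V \<inter> G \<noteq> {}}" if x: "x \<in> topspace X" for x
  proof -
    obtain W where W: "alpha_set_in X W" "x \<in> W" and finW: "finite {V \<in> \<V>. V \<inter> W \<noteq> {}}"
      using fin x by (auto simp: locally_finite_in_def)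
    let ?G = "X interior_of (X closure_of (X interior_of W))"
    have "{V \<in> \<V>. V \<inter> ?G \<noteq> {}} \<subseteq> {V \<in> \<V>. V \<inter> W \<noteq> {}}"
      using semi semi_open_in_meets_alpha_set_in by blast
    then have "finite {V \<in> \<V>. V \<inter> ?G \<noteq> {}}"
      using finW by (rule finite_subset)
    moreover have "x \<in> ?G"
      using W by (auto simp: alpha_set_in_def)
    ultimately show ?thesis
      using openin_interior_of by blast
  qed
  then show "locally_finite_in X \<V>"
    using fin by (simp add: locally_finite_in_def)
next
  assume fin: "locally_finite_in X \<V>"
  have "\<exists>W. alpha_set_in X W \<and> x \<in> W \<and> finite {V \<in> \<V>. V \<inter> W \<noteq> {}}"
    if x: "x \<in> topspace X" for x
  proof -
    from fin[unfolded locally_finite_in_def, THEN conjunct2, rule_format, OF x]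
    obtain G where "openin X G" "x \<in> G" "finite {V \<in> \<V>. V \<inter> G \<noteq> {}}"
      by (elim exE conjE) (rule that; assumption)
    then show ?thesis
      by (intro exI[of _ G]) (simp add: openin_imp_alpha_set_in)
  qed
  then show "locally_finite_in (alpha_topology X) \<V>"
    using fin by (simp add: locally_finite_in_def)
qed

lemma regular_closed_refinable_alpha_topology:
  "regular_closed_refinable (alpha_topology X) \<longleftrightarrow> regular_closed_refinable X"
proof -
  have "locally_finite_in (alpha_topology X) \<V> \<longleftrightarrow> locally_finite_in X \<V>"
    if "\<forall>V\<in>\<V>. regular_closed_in X V" for \<V>
    using that by (simp add: locally_finite_in_alpha_topology regular_closed_in_imp_semi_open_in)
  then have "locally_finite_in (alpha_topology X) \<V> \<and> (\<forall>V\<in>\<V>. regular_closed_in X V) \<and> P \<longleftrightarrow>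
      locally_finite_in X \<V> \<and> (\<forall>V\<in>\<V>. regular_closed_in X V) \<and> P" for \<V> P
    by blast
  then show ?thesis
    by (simp only: regular_closed_refinable_def regular_closed_in_alpha_topology
        topspace_alpha_topology)
qed

theorem theorem2p7:
  fixes X :: "'a topology"
  shows "(para_S_closed X \<longleftrightarrow> regular_closed_refinable X) \<and>
         (regular_closed_refinable X \<longleftrightarrow> regular_closed_refinable (alpha_topology X)) \<and>
         (regular_closed_refinable (alpha_topology X) \<longleftrightarrow> para_S_closed (alpha_topology X))"
  by (simp add: para_S_closed_iff_regular_closed_refinable regular_closed_refinable_alpha_topology)

end
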